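(* Let $q_1,q_2$ be the two models, and $\mathrm{sharded\text{-}safe}:\mathcal C\to\{q_1,q_2\}$ the function, returned by the Sharded-Safe procedure on a dataset $\mathcal D$ in which each $C\in\mathcal C$ appears in at most one datapoint. Let $\Delta\in\{\Delta_{\max},\Delta_{\mathrm{KL}}\}$ and let $p$ be the model returned by the CP-$\Delta$ algorithm, i.e. \[ p(y|x)=\begin{cases}\dfrac{\min\{q_1(y|x),q_2(y|x)\}}{Z(x)} & \text{if }\Delta=\Delta_{\max},\\[2mm] \dfrac{\sqrt{q_1(y|x)\,q_2(y|x)}}{Z(x)} & \text{if }\Delta=\Delta_{\mathrm{KL}},\end{cases} \] where $Z(x)$ is the normalizing constant, assumed positive. Then for every prompt $x$, $p$ is $k_x$-near access-free on $x$ with respect to $\mathcal C$, $\mathrm{sharded\text{-}safe}$ and $\Delta$, where \[ k_x\le\begin{cases}-\log\bigl(1-\mathsf{TV}(q_1(\cdot|x),q_2(\cdot|x))\bigr) & \text{if }\Delta=\Delta_{\max},\\ -2\log\bigl(1-\mathsf{H}^2(q_1(\cdot|x),q_2(\cdot|x))\bigr) & \text{if }\Delta=\Delta_{\mathrm{KL}}.\end{cases} \]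
   Context: $\mathcal X$ is a set of prompts and $\mathcal Y$ a discrete (countable) set of outputs. A conditional generative model assigns to each $x\in\mathcal X$ a probability mass function $p(\cdot|x)$ on $\mathcal Y$; $\mathcal M$ is the set of such models. All logarithms are base 2. Divergences for distributions $\rho,\mu$ on $\mathcal Y$: $\Delta_{\max}(\rho\|\mu)=\max_{y\in\mathrm{Supp}(\rho)}\log\frac{\rho(y)}{\mu(y)}$ (supremum if infinite support) and $\Delta_{\mathrm{KL}}(\rho\|\mu)=\mathbb E_{y\sim\rho}\log\frac{\rho(y)}{\mu(y)}$. Total variation: $\mathsf{TV}(\rho,\mu)=\frac12\sum_y|\rho(y)-\mu(y)|$. Squared Hellinger: $\mathsf H^2(\rho,\mu)=1-\sum_y\sqrt{\rho(y)\mu(y)}$. Given a function $\mathrm{safe}:\mathcal C\to\mathcal M$, $C\mapsto\mathrm{safe}_C$, and a divergence $\Delta$, a model $p$ is $k_x$-near access-free ($k_x$-NAF) on prompt $x$ with respect to $\mathcal C$, $\mathrm{safe}$, $\Delta$ if $\Delta(p(\cdot|x)\,\|\,\mathrm{safe}_C(\cdot|x))\le k_x$ for every $C\in\mathcal C$. Sharded-Safe procedure: $\mathcal A$ is a learning algorithm mapping datasets to models in $\mathcal M$; $\mathcal D$ is a dataset and $\mathcal C$ is the set of copyrighted pieces of data contained in its datapoints. Partition $\mathcal D$ into two datasets $\mathcal D_1,\mathcal D_2$; set $q_1=\mathcal A(\mathcal D_1)$, $q_2=\mathcal A(\mathcal D_2)$; define $\mathrm{sharded\text{-}safe}(C)=q_i$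 for an $i$ such that $C$ does not appear in $\mathcal D_i$ (such $i$ exists because $C$ appears in at most one datapoint). CP-$\Delta$ algorithm: run Sharded-Safe on $\mathcal D$ to obtain $q_1,q_2$, and return the model $p$ given by the formula in the claim. *)

theory Defs
  imports "HOL-Probability.Probability" "HOL-Library.Multiset"
begin

section \<open>Models and divergences\<close>

type_synonym ('x, 'y) model = "'x \<Rightarrow> 'y pmf"

definition total_variation :: "'y::countable pmf \<Rightarrow> 'y pmf \<Rightarrow> real" where
  "total_variation \<rho> \<mu> = (1/2) * (\<Sum>\<^sub>\<infinity>y. \<bar>pmf \<rho> y - pmf \<mu> y\<bar>)"

definition sq_hellinger :: "'y::countable pmf \<Rightarrow> 'y pmf \<Rightarrow> real" where
  "sq_hellinger \<rho> \<mu> = 1 - (\<Sum>\<^sub>\<infinity>y. sqrt (pmf \<rho> y * pmf \<mu> y))"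

text \<open>
  The logarithm of the likelihood ratio is only used on the support of \<open>\<rho>\<close>; there the ratio
  is \<open>\<infinity>\<close> when \<open>\<mu>\<close> vanishes, whereas HOL's real division would give \<open>0\<close>.
\<close>

definition log_ratio :: "'y pmf \<Rightarrow> 'y pmf \<Rightarrow> 'y \<Rightarrow> ereal" where
  "log_ratio \<rho> \<mu> y = (if pmf \<mu> y = 0 then \<infinity> else ereal (log 2 (pmf \<rho> y / pmf \<mu> y)))"

definition div_max :: "'y::countable pmf \<Rightarrow> 'y pmf \<Rightarrow> ereal" where
  "div_max \<rho> \<mu> = (SUP y\<in>set_pmf \<rho>. log_ratio \<rho> \<mu> y)"

text \<open>
  Expectation of an extended-real function as positive part minus negative part
  (\<open>e2ennreal\<close> sends negative numbers to \<open>0\<close>). The Bochner integral, and hence the library's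
  \<open>KL_divergence\<close>, returns \<open>0\<close> on non-integrable functions and is therefore not suitable for
  divergences that may be infinite.  For \<open>log_ratio \<rho> \<mu>\<close> under \<open>\<rho>\<close> the negative part always
  has a finite integral, so no \<open>\<infinity> - \<infinity>\<close> arises below.
\<close>

definition expectation_ereal :: "'y pmf \<Rightarrow> ('y \<Rightarrow> ereal) \<Rightarrow> ereal" where
  "expectation_ereal \<rho> f =
     enn2ereal (\<integral>\<^sup>+ y. e2ennreal (f y) \<partial>measure_pmf \<rho>) -
     enn2ereal (\<integral>\<^sup>+ y. e2ennreal (- f y) \<partial>measure_pmf \<rho>)"

definition div_KL :: "'y::countable pmf \<Rightarrow> 'y pmf \<Rightarrow> ereal" where
  "div_KL \<rho> \<mu> = expectation_ereal \<rho> (log_ratio \<rho> \<mu>)"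

text \<open>
  The algorithm branches on the choice of divergence. A datatype of names is used because the
  functions \<open>div_max\<close> and \<open>div_KL\<close> themselves coincide on a one-element output type.
\<close>

datatype divergence = Max_Div | KL_Div

fun div_of :: "divergence \<Rightarrow> 'y::countable pmf \<Rightarrow> 'y pmf \<Rightarrow> ereal" where
  "div_of Max_Div = div_max"
| "div_of KL_Div = div_KL"


section \<open>Near access-freeness\<close>

definition near_access_free ::
  "('x, 'y) model \<Rightarrow> real \<Rightarrow> 'x \<Rightarrow> 'c set \<Rightarrow> ('c \<Rightarrow> ('x, 'y) model) \<Rightarrow>
   ('y pmf \<Rightarrow> 'y pmf \<Rightarrow> ereal) \<Rightarrow> bool" where
  "near_access_free p k x \<C> safe \<Delta> \<longleftrightarrow> (\<forall>C\<in>\<C>. \<Delta> (p x) (safe C x) \<le> ereal k)"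


section \<open>The Sharded-Safe procedure\<close>

text \<open>
  Datasets are finite multisets of datapoints, so repeated datapoints count separately;
  \<open>pieces z\<close> is the set of copyrighted pieces of data contained in the datapoint \<open>z\<close>.
\<close>

definition copyrighted :: "('d \<Rightarrow> 'c set) \<Rightarrow> 'd multiset \<Rightarrow> 'c set" where
  "copyrighted pieces D = (\<Union>z\<in>set_mset D. pieces z)"

definition appearances :: "('d \<Rightarrow> 'c set) \<Rightarrow> 'c \<Rightarrow> 'd multiset \<Rightarrow> nat" where
  "appearances pieces C D = size {#z \<in># D. C \<in> pieces z#}"

text \<open>
  The procedure leaves the partition of the dataset, and the index \<open>i\<close> when both are possible,
  unspecified; the relation below holds of every possible output \<open>(q\<^sub>1, q\<^sub>2, safe)\<close>.
  The values of \<open>safe\<close> outside \<open>copyrighted pieces D\<close> are irrelevant.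
\<close>

definition sharded_safe_output ::
  "('d \<Rightarrow> 'c set) \<Rightarrow> ('d multiset \<Rightarrow> ('x, 'y) model) \<Rightarrow> 'd multiset \<Rightarrow>
   ('x, 'y) model \<Rightarrow> ('x, 'y) model \<Rightarrow> ('c \<Rightarrow> ('x, 'y) model) \<Rightarrow> bool" where
  "sharded_safe_output pieces A D q1 q2 safe \<longleftrightarrow>
     (\<exists>D1 D2. D = D1 + D2 \<and> q1 = A D1 \<and> q2 = A D2 \<and>
        (\<forall>C\<in>copyrighted pieces D.
           (C \<notin> copyrighted pieces D1 \<and> safe C = q1) \<or>
           (C \<notin> copyrighted pieces D2 \<and> safe C = q2)))"


section \<open>The model returned by the CP-\<open>\<Delta>\<close> algorithm\<close>

fun cp_weight ::
  "divergence \<Rightarrow> ('x, 'y) model \<Rightarrow> ('x, 'y) model \<Rightarrow> 'x \<Rightarrow> 'y::countable \<Rightarrow> real" where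
  "cp_weight Max_Div q1 q2 x y = min (pmf (q1 x) y) (pmf (q2 x) y)"
| "cp_weight KL_Div q1 q2 x y = sqrt (pmf (q1 x) y * pmf (q2 x) y)"

definition cp_Z ::
  "divergence \<Rightarrow> ('x, 'y::countable) model \<Rightarrow> ('x, 'y) model \<Rightarrow> 'x \<Rightarrow> real" where
  "cp_Z \<Delta> q1 q2 x = (\<Sum>\<^sub>\<infinity>y. cp_weight \<Delta> q1 q2 x y)"

definition cp_model ::
  "divergence \<Rightarrow> ('x, 'y::countable) model \<Rightarrow> ('x, 'y) model \<Rightarrow> ('x, 'y) model" where
  "cp_model \<Delta> q1 q2 x = embed_pmf (\<lambda>y. cp_weight \<Delta> q1 q2 x y / cp_Z \<Delta> q1 q2 x)"

text \<open>
  \<open>embed_pmf\<close> is only meaningful on functions that are probability mass functions; the lemma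
  \<open>pmf_cp_model\<close> shows that this is the case whenever the normalizing constant is positive.
\<close>

lemma cp_weight_nonneg: "0 \<le> cp_weight \<Delta> q1 q2 x y"
  by (cases \<Delta>) auto

lemma cp_weight_le: "cp_weight \<Delta> q1 q2 x y \<le> pmf (q1 x) y + pmf (q2 x) y"
proof (cases \<Delta>)
  case KL_Div
  have "sqrt (pmf (q1 x) y * pmf (q2 x) y) \<le> (pmf (q1 x) y + pmf (q2 x) y) / 2"
    by (rule arith_geo_mean_sqrt) auto
  also have "\<dots> \<le> pmf (q1 x) y + pmf (q2 x) y"
    by (simp add: field_simps)
  finally show ?thesis
    using KL_Div by simp
qed (auto simp: min_def)

lemma integrable_cp_weight: "integrable (count_space UNIV) (cp_weight \<Delta> q1 q2 x)"
proof (rule Bochner_Integration.integrable_bound)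
  show "integrable (count_space UNIV) (\<lambda>y. pmf (q1 x) y + pmf (q2 x) y)"
    by (intro Bochner_Integration.integrable_add integrable_pmf)
  show "AE y in count_space UNIV. norm (cp_weight \<Delta> q1 q2 x y) \<le> norm (pmf (q1 x) y + pmf (q2 x) y)"
    using cp_weight_nonneg[of \<Delta> q1 q2 x] cp_weight_le[of \<Delta> q1 q2 x] by auto
qed auto

lemma cp_Z_eq_integral: "cp_Z \<Delta> q1 q2 x = integral\<^sup>L (count_space UNIV) (cp_weight \<Delta> q1 q2 x)"
  unfolding cp_Z_def infsetsum_def[symmetric]
  by (rule infsetsum_infsum[symmetric])
     (use integrable_cp_weight in \<open>simp add: abs_summable_on_def\<close>)

lemma pmf_cp_model:
  assumes "cp_Z \<Delta> q1 q2 x > 0"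
  shows "pmf (cp_model \<Delta> q1 q2 x) y = cp_weight \<Delta> q1 q2 x y / cp_Z \<Delta> q1 q2 x"
  unfolding cp_model_def
proof (rule pmf_embed_pmf)
  show "0 \<le> cp_weight \<Delta> q1 q2 x y / cp_Z \<Delta> q1 q2 x" for y
    using assms cp_weight_nonneg[of \<Delta> q1 q2 x y] by simp
  have "(\<integral>\<^sup>+ y. ennreal (cp_weight \<Delta> q1 q2 x y / cp_Z \<Delta> q1 q2 x) \<partial>count_space UNIV)
      = ennreal (\<integral>y. cp_weight \<Delta> q1 q2 x y / cp_Z \<Delta> q1 q2 x \<partial>count_space UNIV)"
    by (rule nn_integral_eq_integral)
       (use assms in \<open>auto intro!: integrable_cp_weight cp_weight_nonneg divide_nonneg_pos\<close>)
  also have "\<dots> = 1"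
    using assms by (simp add: cp_Z_eq_integral)
  finally show "(\<integral>\<^sup>+ y. ennreal (cp_weight \<Delta> q1 q2 x y / cp_Z \<Delta> q1 q2 x) \<partial>count_space UNIV) = 1" .
qed

end

theory Submission
  imports Defs
begin

text \<open>
  On the support of \<open>p\<close> both \<open>q\<^sub>i\<close> are positive. For \<open>\<Delta>\<^sub>m\<^sub>a\<^sub>x\<close> the likelihood ratio \<open>p / q\<^sub>i\<close> is at
  most \<open>1 / Z\<close>, and \<open>Z = 1 - TV\<close> because \<open>min a b = (a + b - \<bar>a - b\<bar>) / 2\<close>. For \<open>\<Delta>\<^sub>K\<^sub>L\<close> we have
  \<open>log (p / q\<^sub>1) + log (p / q\<^sub>2) = -2 log Z\<close> pointwise, so the two divergences add up to
  \<open>-2 log (1 - H\<^sup>2)\<close>, and each of them is nonnegative by Gibbs' inequality.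
\<close>

text \<open>The definitions use unordered sums; as integrals over \<open>count_space\<close> they
  are open to linearity and to the pmf lemmas.\<close>

lemma infsum_eq_integral:
  fixes f :: "'a \<Rightarrow> real"
  assumes "integrable (count_space UNIV) f"
  shows "(\<Sum>\<^sub>\<infinity>y. f y) = integral\<^sup>L (count_space UNIV) f"
  using infsetsum_infsum[of f UNIV] assms
  by (simp add: abs_summable_on_def infsetsum_def)

lemma cp_Z_Max_Div: "cp_Z Max_Div q1 q2 x = 1 - total_variation (q1 x) (q2 x)"
proof -
  let ?M = "count_space UNIV" and ?a = "pmf (q1 x)" and ?b = "pmf (q2 x)"
  have min_eq: "cp_weight Max_Div q1 q2 x = (\<lambda>y. (?a y + ?b y - \<bar>?a y - ?b y\<bar>) / 2)"
    by (auto simp: min_def fun_eq_iff)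
  have int: "integrable ?M (\<lambda>y. \<bar>?a y - ?b y\<bar>)"
    by (intro integrable_abs Bochner_Integration.integrable_diff integrable_pmf)
  have "cp_Z Max_Div q1 q2 x = (integral\<^sup>L ?M ?a + integral\<^sup>L ?M ?b - (\<integral>y. \<bar>?a y - ?b y\<bar> \<partial>?M)) / 2"
    unfolding cp_Z_eq_integral min_eq using int by (simp add: integrable_pmf)
  also have "\<dots> = 1 - total_variation (q1 x) (q2 x)"
    by (simp add: total_variation_def infsum_eq_integral[OF int] integral_pmf)
  finally show ?thesis .
qed

lemma cp_Z_KL_Div: "cp_Z KL_Div q1 q2 x = 1 - sq_hellinger (q1 x) (q2 x)"
  by (simp add: cp_Z_def sq_hellinger_def)

text \<open>By this symmetry, a bound against the first model is also one against the
  second.\<close>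

lemma cp_model_commute: "cp_model \<Delta> q1 q2 = cp_model \<Delta> q2 q1"
  and cp_Z_commute: "cp_Z \<Delta> q1 q2 = cp_Z \<Delta> q2 q1"
proof -
  have "cp_weight \<Delta> q1 q2 x y = cp_weight \<Delta> q2 q1 x y" for x y
    by (cases \<Delta>) (auto simp: min.commute mult.commute)
  then show "cp_model \<Delta> q1 q2 = cp_model \<Delta> q2 q1" and "cp_Z \<Delta> q1 q2 = cp_Z \<Delta> q2 q1"
    by (simp_all add: cp_model_def cp_Z_def fun_eq_iff)
qed

text \<open>Integrability of \<open>g\<close> makes both parts finite, so the difference is an
  ordinary real subtraction. Agreement on the support suffices, since the rest is a null set; this
  makes \<open>log_ratio\<close> accessible despite its value \<infinity>.\<close>

lemma expectation_ereal_eq_integral: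
  assumes "integrable (measure_pmf \<rho>) g" and "\<And>y. y \<in> set_pmf \<rho> \<Longrightarrow> f y = ereal (g y)"
  shows "expectation_ereal \<rho> f = ereal (\<integral>y. g y \<partial>measure_pmf \<rho>)"
proof -
  have pos: "(\<integral>\<^sup>+ y. e2ennreal (f y) \<partial>measure_pmf \<rho>) = (\<integral>\<^sup>+ y. ennreal (g y) \<partial>measure_pmf \<rho>)"
    and neg: "(\<integral>\<^sup>+ y. e2ennreal (- f y) \<partial>measure_pmf \<rho>) = (\<integral>\<^sup>+ y. ennreal (- g y) \<partial>measure_pmf \<rho>)"
    using assms(2) by (auto intro!: nn_integral_cong_AE simp: AE_measure_pmf_iff ennreal_def)
  have "(\<integral>\<^sup>+ y. ennreal (g y) \<partial>measure_pmf \<rho>) < \<top>"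
    "(\<integral>\<^sup>+ y. ennreal (- g y) \<partial>measure_pmf \<rho>) < \<top>"
    using assms(1) by (simp_all add: real_integrable_def less_top)
  then show ?thesis
    unfolding expectation_ereal_def pos neg real_lebesgue_integral_def[OF assms(1)]
    by (metis enn2real_nonneg enn2ereal_ennreal ennreal_enn2real ereal_minus(1))
qed

lemma
  fixes \<rho> \<mu> :: "'a pmf"
  shows integrable_pmf_ratio: "integrable (measure_pmf \<rho>) (\<lambda>y. pmf \<mu> y / pmf \<rho> y)"
    and integral_pmf_ratio_le: "(\<integral>y. pmf \<mu> y / pmf \<rho> y \<partial>measure_pmf \<rho>) \<le> 1"
proof -
  have "(\<integral>\<^sup>+ y. ennreal (pmf \<mu> y / pmf \<rho> y) \<partial>measure_pmf \<rho>)
      = (\<integral>\<^sup>+ y. ennreal (pmf \<rho> y) * ennreal (pmf \<mu> y / pmf \<rho> y) \<partial>count_space UNIV)"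
    by (rule nn_integral_measure_pmf)
  \<comment> \<open>The weight cancels where \<open>pmf \<rho> y > 0\<close>. Elsewhere the left
    integrand is 0, so any mass of \<open>\<mu>\<close> outside the support of \<open>\<rho>\<close>
    is lost.\<close>
  also have "\<dots> \<le> (\<integral>\<^sup>+ y. ennreal (pmf \<mu> y) \<partial>count_space UNIV)"
    by (intro nn_integral_mono) (simp flip: ennreal_mult)
  also have "\<dots> = 1"
    by (simp add: nn_integral_pmf)
  finally have le: "(\<integral>\<^sup>+ y. ennreal (pmf \<mu> y / pmf \<rho> y) \<partial>measure_pmf \<rho>) \<le> 1" .
  then show int: "integrable (measure_pmf \<rho>) (\<lambda>y. pmf \<mu> y / pmf \<rho> y)"
    by (intro integrableI_nonneg) (auto simp: le_less_trans[OF _ ennreal_one_less_top])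
  show "(\<integral>y. pmf \<mu> y / pmf \<rho> y \<partial>measure_pmf \<rho>) \<le> 1"
    using le by (subst (asm) nn_integral_eq_integral[OF int]) (auto simp flip: ennreal_1)
qed

lemma log2_le_diff:
  fixes t :: real
  assumes "t > 0"
  shows "log 2 t \<le> (t - 1) / ln 2"
  using ln_le_minus_one[OF assms] by (simp add: log_def divide_right_mono)

text \<open>On the support, squaring \<open>mean\<close> gives
  \<open>log (\<rho>/\<mu>) = - 2 * log z + log (\<nu>/\<rho>)\<close>, and the last term has
  nonpositive expectation under \<open>\<rho>\<close>. Working pointwise avoids adding two
  divergences whose finiteness is not yet known.\<close>

lemma div_KL_le_of_geometric_mean:
  fixes \<rho> \<mu> \<nu> :: "'y::countable pmf"
  assumes "z > 0" and mean: "\<And>y. y \<in> set_pmf \<rho> \<Longrightarrow> pmf \<rho> y = sqrt (pmf \<mu> y * pmf \<nu> y) / z"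
  shows "div_KL \<rho> \<mu> \<le> ereal (- 2 * log 2 z)"
proof -
  define g where "g y = log 2 (pmf \<rho> y / pmf \<mu> y)" for y
  \<comment> \<open>\<open>h\<close> and \<open>- l\<close> enclose \<open>g\<close>: both come from
    \<open>log2_le_diff\<close>, at \<open>\<nu>/\<rho>\<close> for the upper bound and at
    \<open>\<mu>/\<rho>\<close> for the lower. Their ratios are integrable, which yields
    integrability of \<open>g\<close>.\<close>
  define h where "h y = - 2 * log 2 z + (pmf \<nu> y / pmf \<rho> y - 1) / ln 2" for y
  define l where "l y = (pmf \<mu> y / pmf \<rho> y - 1) / ln 2" for y
  have pos: "pmf \<rho> y > 0" "pmf \<mu> y > 0" "pmf \<nu> y > 0" if "y \<in> set_pmf \<rho>" for y
  proof -
    show r: "pmf \<rho> y > 0"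
      using that by (rule pmf_positive)
    then have "pmf \<mu> y * pmf \<nu> y \<noteq> 0"
      using mean[OF that] by auto
    then show "pmf \<mu> y > 0" "pmf \<nu> y > 0"
      by (auto simp: less_le)
  qed
  have g_le: "g y \<le> h y" if y: "y \<in> set_pmf \<rho>" for y
  proof -
    have "log 2 (pmf \<rho> y) = (log 2 (pmf \<mu> y) + log 2 (pmf \<nu> y)) / 2 - log 2 z"
      using pos[OF y] \<open>z > 0\<close>
      by (subst mean[OF y]) (simp add: log_divide log_mult log_def ln_sqrt ln_mult ln_div field_simps)
    then have "g y = - 2 * log 2 z + log 2 (pmf \<nu> y / pmf \<rho> y)"
      using pos[OF y] by (simp add: g_def log_divide field_simps)
    then show ?thesis
      using log2_le_diff[of "pmf \<nu> y / pmf \<rho> y"] pos[OF y] by (simp add: h_def)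
  qed
  have g_ge: "- l y \<le> g y" if y: "y \<in> set_pmf \<rho>" for y
    using log2_le_diff[of "pmf \<mu> y / pmf \<rho> y"] pos[OF y] by (simp add: g_def l_def log_divide)
  have int_h: "integrable (measure_pmf \<rho>) h" and int_l: "integrable (measure_pmf \<rho>) l"
    unfolding h_def l_def
    by (intro Bochner_Integration.integrable_add Bochner_Integration.integrable_diff
        integrable_divide measure_pmf.integrable_const integrable_pmf_ratio)+
  have int_g: "integrable (measure_pmf \<rho>) g"
  proof (rule Bochner_Integration.integrable_bound)
    show "integrable (measure_pmf \<rho>) (\<lambda>y. \<bar>h y\<bar> + \<bar>l y\<bar>)"
      using int_h int_l by simp
    show "AE y in measure_pmf \<rho>. norm (g y) \<le> norm (\<bar>h y\<bar> + \<bar>l y\<bar>)"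
      using g_le g_ge by (force simp: AE_measure_pmf_iff)
  qed simp
  have "div_KL \<rho> \<mu> = ereal (\<integral>y. g y \<partial>measure_pmf \<rho>)"
    unfolding div_KL_def using int_g
    by (rule expectation_ereal_eq_integral) (use pos in \<open>force simp: log_ratio_def g_def\<close>)
  also have "(\<integral>y. g y \<partial>measure_pmf \<rho>) \<le> (\<integral>y. h y \<partial>measure_pmf \<rho>)"
    using int_g int_h g_le by (intro integral_mono_AE) (auto simp: AE_measure_pmf_iff)
  also have "\<dots> = - 2 * log 2 z + ((\<integral>y. pmf \<nu> y / pmf \<rho> y \<partial>measure_pmf \<rho>) - 1) / ln 2"
    unfolding h_def by (simp add: integrable_pmf_ratio)
  \<comment> \<open>Gibbs' inequality in linearized form: the ratio has expectation at most 1, so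
    the correction term is nonpositive.\<close>
  also have "\<dots> \<le> - 2 * log 2 z"
    using integral_pmf_ratio_le[where \<rho> = \<rho> and \<mu> = \<nu>] by (simp add: divide_le_0_iff)
  finally show ?thesis
    by simp
qed

lemma div_max_cp_model_le:
  assumes Z: "cp_Z Max_Div q1 q2 x > 0"
  shows "div_max (cp_model Max_Div q1 q2 x) (q1 x) \<le> ereal (- log 2 (cp_Z Max_Div q1 q2 x))"
  unfolding div_max_def
proof (rule SUP_least)
  let ?p = "cp_model Max_Div q1 q2 x" and ?Z = "cp_Z Max_Div q1 q2 x"
  fix y assume "y \<in> set_pmf ?p"
  then have p: "pmf ?p y > 0"
    by (rule pmf_positive)
  have eq: "pmf ?p y = min (pmf (q1 x) y) (pmf (q2 x) y) / ?Z"
    using pmf_cp_model[OF Z] by simp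
  \<comment> \<open>A positive minimum forces \<open>q1\<close> to be positive at \<open>y\<close>,
    which selects the finite branch of \<open>log_ratio\<close>.\<close>
  with p Z have q1: "pmf (q1 x) y > 0"
    by (simp add: zero_less_divide_iff)
  have "pmf ?p y \<le> pmf (q1 x) y / ?Z"
    unfolding eq using Z by (intro divide_right_mono) auto
  then have "pmf ?p y / pmf (q1 x) y \<le> 1 / ?Z"
    using q1 Z by (simp add: field_simps)
  then have "log 2 (pmf ?p y / pmf (q1 x) y) \<le> log 2 (1 / ?Z)"
    using p q1 Z by (subst log_le_cancel_iff) auto
  then show "log_ratio ?p (q1 x) y \<le> ereal (- log 2 ?Z)"
    using q1 Z by (simp add: log_ratio_def log_divide)
qed

lemma div_KL_cp_model_le:
  assumes "cp_Z KL_Div q1 q2 x > 0"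
  shows "div_KL (cp_model KL_Div q1 q2 x) (q1 x) \<le> ereal (- 2 * log 2 (cp_Z KL_Div q1 q2 x))"
  using pmf_cp_model[OF assms] by (intro div_KL_le_of_geometric_mean[OF assms, of _ _ "q2 x"]) simp

theorem theorem3p1:
  fixes pieces :: "'d \<Rightarrow> 'c set"
    and A :: "'d multiset \<Rightarrow> ('x, 'y::countable) model"
    and D :: "'d multiset"
    and q1 q2 p :: "('x, 'y) model"
    and sharded_safe :: "'c \<Rightarrow> ('x, 'y) model"
    and \<Delta> :: divergence
  assumes "\<forall>C\<in>copyrighted pieces D. appearances pieces C D \<le> 1"
    and "sharded_safe_output pieces A D q1 q2 sharded_safe"
    and "\<forall>x. cp_Z \<Delta> q1 q2 x > 0"
    and "p = cp_model \<Delta> q1 q2"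
  shows "\<forall>x. \<exists>k::real.
     k \<le> (case \<Delta> of
            Max_Div \<Rightarrow> - log 2 (1 - total_variation (q1 x) (q2 x))
          | KL_Div \<Rightarrow> - 2 * log 2 (1 - sq_hellinger (q1 x) (q2 x))) \<and>
     near_access_free p k x (copyrighted pieces D) sharded_safe (div_of \<Delta>)"
proof
  fix x
  let ?k = "case \<Delta> of
            Max_Div \<Rightarrow> - log 2 (1 - total_variation (q1 x) (q2 x))
          | KL_Div \<Rightarrow> - 2 * log 2 (1 - sq_hellinger (q1 x) (q2 x))"
  \<comment> \<open>The distances enter only through the normalizing constant, in which the
    divergence bounds are stated.\<close>
  have k: "?k = (case \<Delta> of Max_Div \<Rightarrow> - log 2 (cp_Z \<Delta> q1 q2 x)
                        | KL_Div \<Rightarrow> - 2 * log 2 (cp_Z \<Delta> q1 q2 x))"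
    by (cases \<Delta>) (simp_all add: cp_Z_Max_Div cp_Z_KL_Div)
  have Z: "cp_Z \<Delta> q1 q2 x > 0" "cp_Z \<Delta> q2 q1 x > 0"
    using assms(3) by (simp_all add: cp_Z_commute[of \<Delta> q2 q1])
  have "div_of \<Delta> (p x) (q1 x) \<le> ereal ?k"
    unfolding k assms(4) using Z(1) div_max_cp_model_le[of q1 q2 x] div_KL_cp_model_le[of q1 q2 x]
    by (cases \<Delta>) simp_all
  moreover have "div_of \<Delta> (p x) (q2 x) \<le> ereal ?k"
    unfolding k assms(4) cp_model_commute[of \<Delta> q1 q2] cp_Z_commute[of \<Delta> q1 q2]
    using Z(2) div_max_cp_model_le[of q2 q1 x] div_KL_cp_model_le[of q2 q1 x]
    by (cases \<Delta>) simp_all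
  \<comment> \<open>Each safe model is one of the two shards' models, so the two bounds above cover
    every piece \<open>C\<close>.\<close>
  moreover have "sharded_safe C \<in> {q1, q2}" if "C \<in> copyrighted pieces D" for C
    using assms(2) that by (auto simp: sharded_safe_output_def)
  ultimately have "near_access_free p ?k x (copyrighted pieces D) sharded_safe (div_of \<Delta>)"
    unfolding near_access_free_def by blast
  \<comment> \<open>The witness for \<open>k\<close> is the claimed bound itself.\<close>
  then show "\<exists>k. k \<le> ?k \<and> near_access_free p k x (copyrighted pieces D) sharded_safe (div_of \<Delta>)"
    by blast
qed

end
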